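(* Let $n\ge 1$ and let $P$ be the Bergman projection of $L^2(B_n)$ onto $\mathbb{H}^2(B_n)$. For every $i=1,\dots,n$, the commutator $\left[P,\frac{\partial}{\partial\overline{z_i}}\right]$ does not admit a continuous extension to $L^2(B_n)$; that is, there is no bounded linear operator on $L^2(B_n)$ which agrees with $P\frac{\partial}{\partial\overline{z_i}}-\frac{\partial}{\partial\overline{z_i}}P$ on $D$.
   Context: $B_n$ is the open unit ball of $\mathbb{C}^n$, $\mu$ is Lebesgue measure on $\mathbb{C}^n$ normalized so that $\mu(B_n)=1$, and $L^2(B_n)=L^2(B_n,d\mu)$ is the space of square-integrable complex-valued functions. $\mathbb{H}^2(B_n)$ (the Bergman space) is the closed subspace of holomorphic functions in $L^2(B_n)$. The Bergman projection $P:L^2(B_n)\to\mathbb{H}^2(B_n)$ is the orthogonal projection, given by $(Pf)(z)=\int_{B_n}\frac{f(w)}{(1-z\cdot\overline{w})^{n+1}}\,d\mu(w)$ with $z\cdot\overline{w}=\sum_{j=1}^n z_j\overline{w_j}$. $D$ denotes the space of all polynomials in $z_1,\dots,z_n,\overline{z_1},\dots,\overline{z_n}$ with complex coefficients, restricted to $B_n$; it is dense in $L^2(B_n)$ and invariant under $P$ and under the derivations considered, so commutators are well defined on $D$. $\frac{\partial}{\partial\overline{z_i}}$ is the conjugate Wirtinger derivative and $[P,Y]=PY-YP$. *)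

theory Defs
  imports "HOL-Analysis.Analysis"
begin

definition unit_ball :: "(complex ^ 'n) set" where
  "unit_ball = ball 0 1"

definition ball_measure :: "(complex ^ 'n) measure" where
  "ball_measure = uniform_measure lebesgue unit_ball"

text \<open>Elements of \<open>L\<^sup>2(B\<^sub>n)\<close> are represented by functions on the whole of \<open>\<complex>\<^sup>n\<close>. Two functions
  represent the same element if they agree almost everywhere with respect to \<^const>\<open>ball_measure\<close>;
  in particular the values outside the ball are irrelevant.\<close>

definition L2_ball :: "(complex ^ 'n \<Rightarrow> complex) set" where
  "L2_ball = {f. f \<in> borel_measurable ball_measure \<and>
                 integrable ball_measure (\<lambda>z. (cmod (f z))\<^sup>2)}"

definition L2_eq :: "(complex ^ 'n \<Rightarrow> complex) \<Rightarrow> (complex ^ 'n \<Rightarrow> complex) \<Rightarrow> bool" where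
  "L2_eq f g \<longleftrightarrow> (AE z in ball_measure. f z = g z)"

definition L2_inner :: "(complex ^ 'n \<Rightarrow> complex) \<Rightarrow> (complex ^ 'n \<Rightarrow> complex) \<Rightarrow> complex" where
  "L2_inner f g = (LINT z|ball_measure. f z * cnj (g z))"

definition L2_norm :: "(complex ^ 'n \<Rightarrow> complex) \<Rightarrow> real" where
  "L2_norm f = sqrt (LINT z|ball_measure. (cmod (f z))\<^sup>2)"

definition L2_bounded_operator ::
    "((complex ^ 'n \<Rightarrow> complex) \<Rightarrow> (complex ^ 'n \<Rightarrow> complex)) \<Rightarrow> bool" where
  "L2_bounded_operator T \<longleftrightarrow>
     (\<forall>f \<in> L2_ball. T f \<in> L2_ball) \<and>
     (\<forall>f \<in> L2_ball. \<forall>g \<in> L2_ball. L2_eq f g \<longrightarrow> L2_eq (T f) (T g)) \<and>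
     (\<forall>f \<in> L2_ball. \<forall>g \<in> L2_ball. L2_eq (T (\<lambda>z. f z + g z)) (\<lambda>z. T f z + T g z)) \<and>
     (\<forall>c. \<forall>f \<in> L2_ball. L2_eq (T (\<lambda>z. c * f z)) (\<lambda>z. c * T f z)) \<and>
     (\<exists>C. \<forall>f \<in> L2_ball. L2_norm (T f) \<le> C * L2_norm f)"

text \<open>Holomorphy in several variables on an open set: the real Frechet derivative exists at every
  point and is complex-linear.\<close>

definition holomorphic_several :: "(complex ^ 'n \<Rightarrow> complex) \<Rightarrow> (complex ^ 'n) set \<Rightarrow> bool" where
  "holomorphic_several f S \<longleftrightarrow>
     (\<forall>z \<in> S. \<exists>f'. (f has_derivative f') (at z) \<and> (\<forall>c v. f' (c *s v) = c * f' v))"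

definition Bergman_space :: "(complex ^ 'n \<Rightarrow> complex) set" where
  "Bergman_space = {f \<in> L2_ball. holomorphic_several f unit_ball}"

text \<open>The orthogonal projection onto the Bergman space. An element of the Bergman space has exactly
  one representative that is holomorphic on the ball and zero outside; the projection returns this
  representative, so that it can be differentiated pointwise on the ball.\<close>

definition Bergman_projection :: "(complex ^ 'n \<Rightarrow> complex) \<Rightarrow> (complex ^ 'n \<Rightarrow> complex)" where
  "Bergman_projection f =
     (THE g. g \<in> Bergman_space \<and> (\<forall>z. z \<notin> unit_ball \<longrightarrow> g z = 0) \<and>
             (\<forall>h \<in> Bergman_space. L2_inner (\<lambda>z. f z - g z) h = 0))"

text \<open>Polynomials in \<open>z\<^sub>1, \<dots>, z\<^sub>n\<close> and their conjugates; \<open>S\<close> is a finite set of pairs of multi-indices.\<close>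

definition conj_polynomials :: "(complex ^ 'n \<Rightarrow> complex) set" where
  "conj_polynomials =
     {f. \<exists>(S :: (('n \<Rightarrow> nat) \<times> ('n \<Rightarrow> nat)) set) (c :: ('n \<Rightarrow> nat) \<Rightarrow> ('n \<Rightarrow> nat) \<Rightarrow> complex).
           finite S \<and>
           f = (\<lambda>z. \<Sum>(a, b)\<in>S. c a b * (\<Prod>j\<in>UNIV. (z $ j) ^ a j * cnj (z $ j) ^ b j))}"

text \<open>\<open>\<partial>/\<partial>z\<^sub>i\<^sup>* = (\<partial>/\<partial>x\<^sub>i + \<i> \<partial>/\<partial>y\<^sub>i) / 2\<close>, where \<open>z\<^sub>i = x\<^sub>i + \<i> y\<^sub>i\<close> and the star denotes conjugation.\<close>

definition wirtinger_conj :: "'n \<Rightarrow> (complex ^ 'n \<Rightarrow> complex) \<Rightarrow> (complex ^ 'n \<Rightarrow> complex)" where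
  "wirtinger_conj i f = (\<lambda>z.
     (vector_derivative (\<lambda>t::real. f (z + t *\<^sub>R axis i 1)) (at 0)
      + \<i> * vector_derivative (\<lambda>t::real. f (z + t *\<^sub>R axis i \<i>)) (at 0)) / 2)"

definition Bergman_commutator ::
    "((complex ^ 'n \<Rightarrow> complex) \<Rightarrow> (complex ^ 'n \<Rightarrow> complex)) \<Rightarrow>
     (complex ^ 'n \<Rightarrow> complex) \<Rightarrow> (complex ^ 'n \<Rightarrow> complex)" where
  "Bergman_commutator Y f = (\<lambda>z. Bergman_projection (Y f) z - Y (Bergman_projection f) z)"

end

theory Submission
  imports Defs "HOL-Complex_Analysis.Cauchy_Integral_Formula" "HOL-Probability.Probability_Measure"
begin

text \<open>On \<open>D\<close> the commutator is \<open>f \<mapsto> P(\<partial>f/\<partial>z\<^sub>i\<^sup>*)\<close>, since \<open>Pf\<close> is holomorphic. Test it on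
  \<open>f\<^sub>k = z\<^sub>i\<^sup>* |z|\<^bsup>2k\<^esup>\<close> with \<open>k \<ge> 1\<close>. As \<open>f\<^sub>k\<close> has weight \<open>-1\<close> under the circle action,
  \<open>Pf\<^sub>k = 0\<close>; its derivative \<open>|z|\<^bsup>2k\<^esup> + k|z\<^sub>i|\<^sup>2|z|\<^bsup>2k-2\<^esup>\<close> is circle invariant, so \<open>P\<close> maps it to
  its mean. By symmetry in the coordinates this mean is at least \<open>(k/n) \<integral>|z|\<^bsup>2k\<^esup>\<close>, which stays away
  from zero because a boundary shell of width \<open>1/k\<close> has mass of order \<open>1/k\<close>. But the norm of
  \<open>f\<^sub>k\<close> tends to zero.\<close>

subsection \<open>Linear isometries preserve Lebesgue measure\<close>

text \<open>Uniqueness of Haar measure in quantitative form: both sides are values of the double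
  integral of \<open>indicator A x * indicator B (x + y)\<close>. Fubini and one translation in each
  variable connect them. The reflection of \<open>A\<close> arises because the last inner integral
  runs over \<open>y\<close> in \<open>indicator A (x - y)\<close>.\<close>

lemma translation_invariant_measure_lborel:
  fixes M :: "'a::euclidean_space measure"
  assumes sets [measurable_cong]: "sets M = sets borel" and "sigma_finite_measure M"
    and inv: "\<And>a. distr M borel (\<lambda>x. a + x) = M"
    and [measurable]: "A \<in> sets borel" "B \<in> sets borel"
  shows "emeasure M A * emeasure lborel B = emeasure M B * emeasure lborel (uminus -` A)"
proof -
  interpret sigma_finite_measure M by fact
  interpret pair_sigma_finite M lborel ..
  have shift: "(\<integral>\<^sup>+x. g (a + x) \<partial>M) = (\<integral>\<^sup>+x. g x \<partial>M)" if "g \<in> borel_measurable borel" for a g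
  proof -
    have "(\<integral>\<^sup>+x. g x \<partial>M) = (\<integral>\<^sup>+x. g x \<partial>distr M borel (\<lambda>x. a + x))"
      by (simp add: inv)
    also have "\<dots> = (\<integral>\<^sup>+x. g (a + x) \<partial>M)"
      using that by (subst nn_integral_distr) auto
    finally show ?thesis by simp
  qed
  have shift': "(\<integral>\<^sup>+x. g (a + x) \<partial>lborel) = (\<integral>\<^sup>+x. g x \<partial>lborel)"
    if "g \<in> borel_measurable borel" for a :: 'a and g
  proof -
    have "(\<integral>\<^sup>+x. g x \<partial>lborel) = (\<integral>\<^sup>+x. g x \<partial>distr lborel borel (\<lambda>x. a + x))"
      by (simp add: lborel_distr_plus)
    also have "\<dots> = (\<integral>\<^sup>+x. g (a + x) \<partial>lborel)"
      using that by (subst nn_integral_distr) auto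
    finally show ?thesis by simp
  qed
  have "emeasure M A * emeasure lborel B = (\<integral>\<^sup>+x. indicator A x * emeasure lborel B \<partial>M)"
    by (simp add: nn_integral_multc sets)
  also have "\<dots> = (\<integral>\<^sup>+x. (\<integral>\<^sup>+y. indicator A x * indicator B (x + y) \<partial>lborel) \<partial>M)"
  proof (rule nn_integral_cong)
    fix x
    have "(\<integral>\<^sup>+y. indicator A x * indicator B (x + y) \<partial>lborel)
        = indicator A x * (\<integral>\<^sup>+y. indicator B (x + y) \<partial>lborel)"
      by (rule nn_integral_cmult) measurable
    also have "\<dots> = indicator A x * emeasure lborel B"
      using shift'[of "indicator B" x] by simp
    finally show "indicator A x * emeasure lborel B
      = (\<integral>\<^sup>+y. indicator A x * indicator B (x + y) \<partial>lborel)" by simp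
  qed
  also have "\<dots> = (\<integral>\<^sup>+y. (\<integral>\<^sup>+x. indicator A x * indicator B (x + y) \<partial>M) \<partial>lborel)"
    by (rule Fubini'[symmetric]) measurable
  \<comment> \<open>Translation by \<open>y\<close> under \<open>M\<close>, with \<open>y\<close>
    fixed, moves the dependence on \<open>y\<close> from \<open>B\<close> to
    \<open>A\<close>.\<close>
  also have "\<dots> = (\<integral>\<^sup>+y. (\<integral>\<^sup>+x. indicator A (x - y) * indicator B x \<partial>M) \<partial>lborel)"
  proof (rule nn_integral_cong)
    fix y
    show "(\<integral>\<^sup>+x. indicator A x * indicator B (x + y) \<partial>M)
        = (\<integral>\<^sup>+x. indicator A (x - y) * indicator B x \<partial>M)"
      using shift[of "\<lambda>x. indicator A (x - y) * indicator B x" y] by (simp add: add.commute)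
  qed
  also have "\<dots> = (\<integral>\<^sup>+x. (\<integral>\<^sup>+y. indicator A (x - y) * indicator B x \<partial>lborel) \<partial>M)"
    by (rule Fubini') measurable
  also have "\<dots> = (\<integral>\<^sup>+x. emeasure lborel (uminus -` A) * indicator B x \<partial>M)"
  proof (rule nn_integral_cong)
    fix x
    have "(\<integral>\<^sup>+y. indicator A (x - y) * indicator B x \<partial>lborel)
        = (\<integral>\<^sup>+y. indicator A (x - y) \<partial>lborel) * indicator B x"
      by (rule nn_integral_multc) measurable
    also have "(\<integral>\<^sup>+y. indicator A (x - y) \<partial>lborel) = (\<integral>\<^sup>+y. indicator A (- y) \<partial>lborel)"
      using shift'[of "\<lambda>y. indicator A (x - y)" x] by simp
    also have "\<dots> = (\<integral>\<^sup>+y. indicator (uminus -` A) y \<partial>lborel)"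
      by (simp add: indicator_def)
    also have "\<dots> = emeasure lborel (uminus -` A)"
      using measurable_sets_borel[of uminus borel A] by simp
    finally show "(\<integral>\<^sup>+y. indicator A (x - y) * indicator B x \<partial>lborel)
        = emeasure lborel (uminus -` A) * indicator B x" .
  qed
  also have "\<dots> = emeasure M B * emeasure lborel (uminus -` A)"
    by (subst nn_integral_cmult) (auto simp: sets mult.commute)
  finally show ?thesis .
qed

text \<open>The image measure is again translation invariant, so it is a multiple of Lebesgue
  measure. An isometry fixes every ball centred at 0, which forces the factor to be 1.\<close>

lemma lborel_distr_linear_isometry:
  fixes f :: "'a::euclidean_space \<Rightarrow> 'a"
  assumes "linear f" and norm: "\<And>x. norm (f x) = norm x"
  shows "distr lborel borel f = lborel"
proof -
  have f: "orthogonal_transformation f"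
    using assms by (simp add: orthogonal_transformation)
  have [measurable]: "f \<in> borel_measurable borel"
    using assms(1) by (simp add: borel_measurable_continuous_onI linear_continuous_on linear_conv_bounded_linear)
  define M where "M = distr lborel borel f"
  have [measurable_cong, simp]: "sets M = sets borel"
    by (simp add: M_def)
  have ball: "emeasure M (ball 0 r) = emeasure lborel (ball (0::'a) r)" for r
  proof -
    have "f -` ball 0 r = ball (0::'a) r" using norm by auto
    then show ?thesis by (simp add: M_def emeasure_distr)
  qed
  have sf: "sigma_finite_measure M"
  proof
    show "\<exists>A. countable A \<and> A \<subseteq> sets M \<and> \<Union> A = space M \<and> (\<forall>a\<in>A. emeasure M a \<noteq> \<infinity>)"
    proof (intro exI[of _ "range (\<lambda>n::nat. ball (0::'a) (real n))"] conjI ballI)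
      have "x \<in> (\<Union>n::nat. ball 0 (real n))" for x :: 'a
        using reals_Archimedean2[of "norm x"] by auto
      then show "(\<Union>n::nat. ball 0 (real n)) = space M" by (auto simp: M_def)
    qed (use emeasure_lborel_ball_finite in \<open>auto simp: ball less_top\<close>)
  qed
  \<comment> \<open>An orthogonal map is onto, so \<open>a = f b\<close>, and shifting by
    \<open>a\<close> after \<open>f\<close> is the same as shifting by \<open>b\<close> before
    \<open>f\<close>.\<close>
  have inv: "distr M borel (\<lambda>x. a + x) = M" for a
  proof -
    obtain b where b: "f b = a" using orthogonal_transformation_surj[OF f] by (metis surjD)
    have "distr M borel (\<lambda>x. a + x) = distr lborel borel (\<lambda>x. f (b + x))"
      unfolding M_def using b linear_add[OF assms(1)] by (subst distr_distr) (auto simp: o_def)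
    also have "\<dots> = distr (distr lborel borel (\<lambda>x. b + x)) borel f"
      by (subst distr_distr) (auto simp: o_def)
    finally show ?thesis by (simp add: lborel_distr_plus M_def)
  qed
  have pos: "emeasure lborel (ball (0::'a) 1) \<noteq> 0"
    using content_ball_pos[of 1 "0::'a"] by (auto simp: measure_def)
  have fin: "emeasure lborel (ball (0::'a) 1) \<noteq> \<infinity>"
    using emeasure_lborel_ball_finite[of "0::'a" 1] by simp
  have "emeasure M A = emeasure lborel A" if [measurable]: "A \<in> sets borel" for A
  proof -
    have "emeasure M A * emeasure lborel (ball (0::'a) 1)
        = emeasure M (ball (0::'a) 1) * emeasure lborel (uminus -` A)"
      by (rule translation_invariant_measure_lborel[OF _ sf inv]) auto
    also have "\<dots> = emeasure lborel (ball (0::'a) 1) * emeasure lborel (uminus -` A)"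
      by (simp add: ball)
    \<comment> \<open>The same identity with Lebesgue measure itself in the role of \<open>M\<close>
      turns the reflected set back into \<open>A\<close>.\<close>
    also have "\<dots> = emeasure lborel A * emeasure lborel (ball (0::'a) 1)"
      by (rule translation_invariant_measure_lborel[symmetric])
        (auto simp: lborel_distr_plus sigma_finite_lborel)
    finally have "emeasure lborel (ball (0::'a) 1) * emeasure M A
        = emeasure lborel (ball (0::'a) 1) * emeasure lborel A"
      by (simp only: mult.commute)
    then show ?thesis using pos fin unfolding ennreal_mult_cancel_left infinity_ennreal_def by blast
  qed
  then show ?thesis unfolding M_def[symmetric] by (intro measure_eqI) auto
qed

subsection \<open>The normalized measure on the ball\<close>

lemma sets_ball_measure [measurable_cong, simp]:
  "sets (ball_measure :: (complex ^ 'n) measure) = sets lebesgue"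
  by (simp add: ball_measure_def)

lemma space_ball_measure [simp]: "space ball_measure = UNIV"
  by (simp add: ball_measure_def)

lemma emeasure_unit_ball:
  "emeasure lebesgue (unit_ball :: (complex ^ 'n) set) \<noteq> 0"
  "emeasure lebesgue (unit_ball :: (complex ^ 'n) set) \<noteq> \<infinity>"
proof -
  show "emeasure lebesgue (unit_ball :: (complex ^ 'n) set) \<noteq> 0"
    using content_ball_pos[of 1 "0 :: complex ^ 'n"] by (auto simp: measure_def unit_ball_def)
  show "emeasure lebesgue (unit_ball :: (complex ^ 'n) set) \<noteq> \<infinity>"
    using emeasure_lborel_ball_finite[of "0 :: complex ^ 'n" 1] by (simp add: unit_ball_def)
qed

lemma sets_unit_ball [measurable]: "unit_ball \<in> sets borel"
  by (simp add: unit_ball_def)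

lemma prob_space_ball_measure: "prob_space (ball_measure :: (complex ^ 'n) measure)"
  unfolding ball_measure_def by (intro prob_space_uniform_measure emeasure_unit_ball)

lemma AE_ball_measure:
  "(AE z in ball_measure. P z) \<longleftrightarrow> (AE z in lebesgue. z \<in> unit_ball \<longrightarrow> P z)"
  unfolding ball_measure_def
  by (rule AE_uniform_measure) (use emeasure_unit_ball in \<open>simp_all only: less_top infinity_ennreal_def simp_thms\<close>)

lemma AE_unit_ball: "AE z in ball_measure. z \<in> unit_ball"
  by (simp add: AE_ball_measure)

text \<open>The restriction of the measure to Borel sets. Lebesgue measurability does not behave
  well under composition with continuous maps or under products, so image measures and Fubini are
  handled on this version.\<close>

definition borel_ball_measure :: "(complex ^ 'n) measure" where
  "borel_ball_measure = distr ball_measure borel (\<lambda>z. z)"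

lemma borel_imp_ball_measurable:
  "f \<in> borel_measurable borel \<Longrightarrow> f \<in> borel_measurable ball_measure"
  by (subst measurable_cong_sets[OF sets_ball_measure refl]) (rule measurable_completion, simp)

lemma id_ball_measurable: "(\<lambda>z. z) \<in> ball_measure \<rightarrow>\<^sub>M borel"
  by (rule borel_imp_ball_measurable) simp

lemma sets_borel_ball_measure [measurable_cong, simp]: "sets borel_ball_measure = sets borel"
  by (simp add: borel_ball_measure_def)

lemma space_borel_ball_measure [simp]: "space borel_ball_measure = UNIV"
  by (simp add: borel_ball_measure_def)

lemma emeasure_ball_measure:
  fixes A :: "(complex ^ 'n) set"
  assumes "A \<in> sets borel"
  shows "emeasure ball_measure A
    = emeasure lborel (unit_ball \<inter> A) / emeasure lborel (unit_ball :: (complex ^ 'n) set)"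
  unfolding ball_measure_def using assms
  by (subst emeasure_uniform_measure) auto

lemma integral_borel_ball_measure:
  fixes f :: "complex ^ 'n \<Rightarrow> 'b::{banach, second_countable_topology}"
  assumes "f \<in> borel_measurable borel"
  shows "integral\<^sup>L borel_ball_measure f = integral\<^sup>L ball_measure f"
  unfolding borel_ball_measure_def by (rule integral_distr[OF id_ball_measurable assms])

lemma integrable_borel_ball_measure:
  fixes f :: "complex ^ 'n \<Rightarrow> 'b::{banach, second_countable_topology}"
  assumes "f \<in> borel_measurable borel"
  shows "integrable borel_ball_measure f \<longleftrightarrow> integrable ball_measure f"
  unfolding borel_ball_measure_def by (rule integrable_distr_eq[OF id_ball_measurable assms])

text \<open>A norm-preserving map satisfies \<open>z \<in> unit_ball\<close> iff
  \<open>f z \<in> unit_ball\<close>, so invariance of Lebesgue measure passes to its normalized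
  restriction.\<close>

lemma distr_borel_ball_measure:
  fixes f :: "complex ^ 'n \<Rightarrow> complex ^ 'n"
  assumes "linear f" and norm: "\<And>x. norm (f x) = norm x"
  shows "distr borel_ball_measure borel f = borel_ball_measure"
proof (rule measure_eqI)
  have f [measurable]: "f \<in> borel_measurable borel"
    using assms(1) by (simp add: borel_measurable_continuous_onI linear_continuous_on linear_conv_bounded_linear)
  fix A assume "A \<in> sets (distr borel_ball_measure borel f)"
  then have A [measurable]: "A \<in> sets borel" by simp
  have fA [measurable]: "f -` A \<in> sets borel"
    using measurable_sets_borel[of f borel A] by simp
  have vim: "unit_ball \<inter> f -` A = f -` (unit_ball \<inter> A)"
    using norm by (auto simp: unit_ball_def)
  have "emeasure lborel (f -` (unit_ball \<inter> A)) = emeasure (distr lborel borel f) (unit_ball \<inter> A)"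
    by (subst emeasure_distr) auto
  also have "\<dots> = emeasure lborel (unit_ball \<inter> A)"
    using lborel_distr_linear_isometry[OF assms] by simp
  finally have *: "emeasure ball_measure (f -` A) = emeasure ball_measure A"
    unfolding emeasure_ball_measure[OF A] emeasure_ball_measure[OF fA] vim by simp
  have "emeasure borel_ball_measure B = emeasure ball_measure B" if "B \<in> sets borel" for B :: "(complex ^ 'n) set"
    unfolding borel_ball_measure_def using that
    by (subst emeasure_distr[OF id_ball_measurable]) auto
  then show "emeasure (distr borel_ball_measure borel f) A = emeasure borel_ball_measure A"
    using * A fA by (subst emeasure_distr) auto
qed simp

subsection \<open>Circle averages\<close>

lemma norm_vec_smult: "norm (c *s z) = cmod c * norm z" for z :: "complex ^ 'n"
  by (simp add: norm_vec_def L2_set_def norm_mult power_mult_distrib real_sqrt_mult flip: sum_distrib_left)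

lemma linear_vec_smult: "linear (\<lambda>z :: complex ^ 'n. c *s z)"
  by (intro linearI) (simp_all add: vec_eq_iff algebra_simps)

lemma bounded_linear_vec_smult_left: "bounded_linear (\<lambda>c. c *s z)" for z :: "complex ^ 'n"
  unfolding linear_conv_bounded_linear[symmetric]
  by (intro linearI) (simp_all add: vec_eq_iff algebra_simps)

text \<open>Chain rule along the complex line through \<open>z\<close>: complex linearity of the
  Frechet derivative makes it multiplication by \<open>h' z\<close>. The closed disc is allowed
  because \<open>norm z < 1\<close> keeps all of \<open>c *s z\<close> inside the open ball.\<close>

lemma holomorphic_several_slice:
  fixes h :: "complex ^ 'n \<Rightarrow> complex"
  assumes "holomorphic_several h unit_ball" and z: "z \<in> unit_ball"
  shows "(\<lambda>c. h (c *s z)) holomorphic_on cball 0 1"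
  unfolding holomorphic_on_def
proof
  fix c :: complex assume "c \<in> cball 0 1"
  then have "cmod c * norm z \<le> norm z"
    by (simp add: mult_left_le_one_le)
  then have "c *s z \<in> unit_ball"
    using z by (simp add: unit_ball_def norm_vec_smult)
  then obtain h' where h': "(h has_derivative h') (at (c *s z))" "\<And>c v. h' (c *s v) = c * h' v"
    using assms(1) by (auto simp: holomorphic_several_def)
  have "((\<lambda>c. c *s z) has_derivative (\<lambda>c. c *s z)) (at c)"
    by (rule bounded_linear_imp_has_derivative[OF bounded_linear_vec_smult_left])
  from has_derivative_compose[OF this h'(1)]
  have "((\<lambda>c. h (c *s z)) has_field_derivative h' z) (at c)"
    by (simp add: has_field_derivative_def h'(2) mult.commute[of _ "h' z"])
  then show "(\<lambda>c. h (c *s z)) field_differentiable at c within cball 0 1"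
    using field_differentiable_at_within field_differentiable_def by blast
qed

text \<open>Cauchy's formula at the centre, with the circle parametrized by the unit interval so
  that the average needs no normalizing factor.\<close>

lemma circle_mean_value:
  assumes "g holomorphic_on cball 0 1"
  shows "((\<lambda>t. g (exp (2 * of_real pi * \<i> * of_real t))) has_integral g 0) {0..1}"
proof -
  have "((\<lambda>u. g u / (u - 0)) has_contour_integral (2 * of_real pi * \<i> * g 0)) (circlepath 0 1)"
    by (rule Cauchy_integral_circlepath_simple[OF assms]) simp
  then have "((\<lambda>t. g (exp (2 * of_real pi * \<i> * of_real t)) * (2 * of_real pi * \<i>))
      has_integral (2 * of_real pi * \<i> * g 0)) {0..1}"
    unfolding has_contour_integral_def
  proof (rule has_integral_eq[rotated])
    fix t :: real assume "t \<in> {0..1}"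
    then show "g (circlepath 0 1 t) / (circlepath 0 1 t - 0) * vector_derivative (circlepath 0 1) (at t within {0..1})
        = g (exp (2 * of_real pi * \<i> * of_real t)) * (2 * of_real pi * \<i>)"
      by (subst vector_derivative_circlepath01) (auto simp: circlepath)
  qed
  from has_integral_divide[OF this, of "2 * of_real pi * \<i>"] show ?thesis by simp
qed

lemma continuous_holomorphic_several:
  assumes "holomorphic_several h unit_ball"
  shows "continuous_on unit_ball h"
  by (rule continuous_at_imp_continuous_on)
    (use assms in \<open>auto simp: holomorphic_several_def intro: has_derivative_continuous\<close>)

lemma borel_measurable_cnj [measurable (raw)]:
  assumes "f \<in> borel_measurable M"
  shows "(\<lambda>z. cnj (f z)) \<in> borel_measurable M"
  using assms by (rule borel_measurable_continuous_on[rotated]) (intro continuous_intros)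

lemma L2_ballI:
  assumes "f \<in> borel_measurable borel" and "\<And>z. z \<in> unit_ball \<Longrightarrow> cmod (f z) \<le> B"
  shows "f \<in> L2_ball"
proof -
  interpret prob_space ball_measure by (rule prob_space_ball_measure)
  have f: "f \<in> borel_measurable ball_measure"
    using assms(1) by (rule borel_imp_ball_measurable)
  have "integrable ball_measure (\<lambda>z. (cmod (f z))\<^sup>2)"
  proof (rule integrable_const_bound)
    show "AE z in ball_measure. norm ((cmod (f z))\<^sup>2) \<le> B\<^sup>2"
      using AE_unit_ball by eventually_elim (use assms(2) in \<open>auto intro: power_mono\<close>)
  qed (use f in measurable)
  with f show ?thesis by (simp add: L2_ball_def)
qed

lemma L2_ball_mult_integrable:
  assumes "f \<in> L2_ball" "g \<in> L2_ball"
  shows "integrable ball_measure (\<lambda>z. f z * cnj (g z))"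
proof (rule Bochner_Integration.integrable_bound)
  show "integrable ball_measure (\<lambda>z. (cmod (f z))\<^sup>2 + (cmod (g z))\<^sup>2)"
    using assms by (auto simp: L2_ball_def)
  have [measurable]: "f \<in> borel_measurable ball_measure" "g \<in> borel_measurable ball_measure"
    using assms by (auto simp: L2_ball_def)
  show "(\<lambda>z. f z * cnj (g z)) \<in> borel_measurable ball_measure"
    by measurable
  have "a * b \<le> a\<^sup>2 + b\<^sup>2" if "0 \<le> a" "0 \<le> b" for a b :: real
    using sum_squares_bound[of a b] mult_nonneg_nonneg[OF that] by linarith
  then show "AE z in ball_measure. norm (f z * cnj (g z)) \<le> norm ((cmod (f z))\<^sup>2 + (cmod (g z))\<^sup>2)"
    by (intro always_eventually) (simp add: norm_mult)
qed

lemma prob_space_borel_ball_measure: "prob_space (borel_ball_measure :: (complex ^ 'n) measure)"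
  unfolding borel_ball_measure_def
  by (rule prob_space.prob_space_distr[OF prob_space_ball_measure id_ball_measurable])

lemma AE_borel_ball_measure: "AE z in borel_ball_measure. z \<in> unit_ball"
  unfolding borel_ball_measure_def
  by (subst AE_distr_iff) (auto simp: AE_unit_ball id_ball_measurable)

lemma continuous_vec_smult [continuous_intros]:
  fixes f :: "'a::topological_space \<Rightarrow> complex" and g :: "'a \<Rightarrow> complex ^ 'n"
  assumes "continuous_on S f" "continuous_on S g"
  shows "continuous_on S (\<lambda>x. f x *s g x)"
  unfolding vector_scalar_mult_def using assms by (intro continuous_intros)

text \<open>Averaging over the circle action, which preserves the measure, replaces \<open>h\<close> by its mean over
  circles, and so by the value at the centre.\<close>

lemma L2_inner_circle_homogeneous:
  fixes f h :: "complex ^ 'n \<Rightarrow> complex"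
  assumes f [measurable]: "f \<in> borel_measurable borel"
    and bound: "\<And>z. z \<in> unit_ball \<Longrightarrow> cmod (f z) \<le> B"
    and hom: "\<And>c z. cmod c = 1 \<Longrightarrow> f (c *s z) = cnj c ^ m * f z"
    and h: "h \<in> Bergman_space"
  shows "L2_inner f h = (LINT z|ball_measure. f z) * cnj (0 ^ m * h 0)"
proof -
  interpret N: prob_space "borel_ball_measure :: (complex ^ 'n) measure"
    by (rule prob_space_borel_ball_measure)
  interpret pair_sigma_finite "lborel :: real measure" "borel_ball_measure :: (complex ^ 'n) measure" ..
  define e :: "real \<Rightarrow> complex" where "e t = exp (2 * of_real pi * \<i> * of_real t)" for t
  have [simp]: "cmod (e t) = 1" for t
    by (simp add: e_def)
  have e [continuous_intros]: "continuous_on S e" for S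
    unfolding e_def by (intro continuous_intros)
  have [measurable]: "e \<in> borel_measurable borel"
    by (intro borel_measurable_continuous_onI e)
  have [measurable]: "(\<lambda>p :: real \<times> (complex ^ 'n). e (fst p) *s snd p) \<in> borel_measurable (borel \<Otimes>\<^sub>M borel)"
    unfolding borel_prod
    by (intro borel_measurable_continuous_onI continuous_intros continuous_on_compose2[OF e[of UNIV]]) auto
  have [measurable]: "(\<lambda>p :: (complex ^ 'n) \<times> real. e (snd p) *s fst p) \<in> borel_measurable (borel \<Otimes>\<^sub>M borel)"
    unfolding borel_prod
    by (intro borel_measurable_continuous_onI continuous_intros continuous_on_compose2[OF e[of UNIV]]) auto
  have hB: "h \<in> L2_ball" and hol: "holomorphic_several h unit_ball"
    using h by (auto simp: Bergman_space_def)
  \<comment> \<open>Cutting off outside the ball gives a Borel function, because \<open>h\<close> is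
    continuous on the ball, whereas \<open>h\<close> itself is only known to be Lebesgue
    measurable.\<close>
  define h' where "h' z = indicator unit_ball z *\<^sub>R h z" for z
  have [measurable]: "h' \<in> borel_measurable borel"
    unfolding h'_def
    by (intro borel_measurable_continuous_on_indicator continuous_holomorphic_several hol sets_unit_ball)
  have AEh: "AE z in ball_measure. h z = h' z"
    using AE_unit_ball by eventually_elim (simp add: h'_def)
  define F where "F z = f z * cnj (h' z)" for z
  have F [measurable]: "F \<in> borel_measurable borel"
    unfolding F_def by measurable
  have "integrable ball_measure (\<lambda>z. f z * cnj (h z))"
    by (rule L2_ball_mult_integrable[OF L2_ballI[OF f bound] hB])
  then have "integrable ball_measure F"
    by (rule integrable_cong_AE_imp) (use AEh in \<open>auto simp: F_def intro!: borel_imp_ball_measurable elim: eventually_mono\<close>)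
  then have intF: "integrable borel_ball_measure F"
    by (simp add: integrable_borel_ball_measure[OF F])
  have inner: "L2_inner f h = integral\<^sup>L borel_ball_measure F"
    unfolding integral_borel_ball_measure[OF F] L2_inner_def
  proof (rule integral_cong_AE)
    show "(\<lambda>z. f z * cnj (h z)) \<in> borel_measurable ball_measure"
      using f[THEN borel_imp_ball_measurable] hB by (auto simp: L2_ball_def)
    show "F \<in> borel_measurable ball_measure"
      using F by (rule borel_imp_ball_measurable)
    show "AE z in ball_measure. f z * cnj (h z) = F z"
      using AEh by eventually_elim (simp add: F_def)
  qed
  \<comment> \<open>Integrating \<open>K\<close> first over \<open>z\<close> gives the inner product
    for each \<open>t\<close> in the unit interval, by rotation invariance. Integrating first over
    \<open>t\<close> gives a circle mean. Fubini equates the two.\<close>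
  define K where "K t z = indicator {0..1} t *\<^sub>R F (e t *s z)" for t :: real and z :: "complex ^ 'n"
  have dist: "distr borel_ball_measure borel (\<lambda>z. e t *s z) = (borel_ball_measure :: (complex ^ 'n) measure)" for t
    by (rule distr_borel_ball_measure[OF linear_vec_smult]) (simp add: norm_vec_smult)
  have [measurable]: "(\<lambda>z :: complex ^ 'n. c *s z) \<in> borel_measurable borel" for c
    by (intro borel_measurable_continuous_onI continuous_intros)
  have rot: "(\<integral>z. g (e t *s z) \<partial>borel_ball_measure) = integral\<^sup>L borel_ball_measure g"
    if [measurable]: "g \<in> borel_measurable borel" for t and g :: "complex ^ 'n \<Rightarrow> 'b::{banach,second_countable_topology}"
  proof -
    have "integral\<^sup>L (distr borel_ball_measure borel (\<lambda>z. e t *s z)) g = (\<integral>z. g (e t *s z) \<partial>borel_ball_measure)"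
      by (rule integral_distr) measurable
    then show ?thesis by (simp add: dist)
  qed
  have roti: "integrable borel_ball_measure (\<lambda>z. F (e t *s z))" for t
  proof -
    have "integrable (distr borel_ball_measure borel (\<lambda>z. e t *s z)) F = integrable borel_ball_measure (\<lambda>z. F (e t *s z))"
      by (rule integrable_distr_eq) measurable
    then show ?thesis by (simp add: dist intF)
  qed
  have K [measurable]: "case_prod K \<in> borel_measurable (lborel \<Otimes>\<^sub>M borel_ball_measure)"
    unfolding K_def case_prod_unfold by measurable
  \<comment> \<open>By rotation invariance the integral of the absolute value over \<open>z\<close>
    does not depend on \<open>t\<close> in the unit interval, so the iterated integral is
    finite.\<close>
  have intK: "integrable (lborel \<Otimes>\<^sub>M borel_ball_measure) (case_prod K)"
  proof (rule Fubini_integrable)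
    have "(\<lambda>t. \<integral>z. norm (case_prod K (t, z)) \<partial>borel_ball_measure)
        = (\<lambda>t. indicator {0..1} t *\<^sub>R (\<integral>z. cmod (F z) \<partial>borel_ball_measure))"
      using rot[of "\<lambda>z. cmod (F z)"] by (auto simp: K_def fun_eq_iff)
    then show "integrable lborel (\<lambda>t. \<integral>z. norm (case_prod K (t, z)) \<partial>borel_ball_measure)"
      by simp
    show "AE t in lborel. integrable borel_ball_measure (\<lambda>z. case_prod K (t, z))"
      using roti by (simp add: K_def)
  qed measurable
  have slice: "(\<integral>t. K t z \<partial>lborel) = f z * cnj (0 ^ m * h 0)" if z: "z \<in> unit_ball" for z
  proof -
    \<comment> \<open>The factor \<open>cnj c ^ m\<close> from the homogeneity of \<open>f\<close>
      is absorbed under the conjugation as \<open>c ^ m\<close>. Hence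
      \<open>g 0 = 0 ^ m * h 0\<close>, which is \<open>h 0\<close> for \<open>m = 0\<close> and
      vanishes for \<open>m > 0\<close>.\<close>
    define g where "g c = c ^ m * h (c *s z)" for c
    have g: "g holomorphic_on cball 0 1"
      unfolding g_def by (intro holomorphic_intros holomorphic_several_slice hol z)
    have inb: "e t *s z \<in> unit_ball" for t
      using z by (simp add: unit_ball_def norm_vec_smult)
    have Fe: "F (e t *s z) = f z * cnj (g (e t))" for t
      using inb by (simp add: F_def h'_def g_def hom)
    have "continuous_on {0..1} (\<lambda>t. g (e t))"
      by (rule continuous_on_compose2[OF holomorphic_on_imp_continuous_on[OF g] e]) auto
    then have int: "set_integrable lborel {0..1} (\<lambda>t. g (e t))"
      by (rule borel_integrable_atLeastAtMost')
    have "(LINT t:{0..1}|lborel. g (e t)) = integral {0..1} (\<lambda>t. g (e t))"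
      by (rule set_borel_integral_eq_integral[OF int])
    also have "\<dots> = g 0"
      unfolding e_def by (rule integral_unique[OF circle_mean_value[OF g]])
    finally have mean: "(LINT t:{0..1}|lborel. g (e t)) = g 0" .
    have "(\<integral>t. K t z \<partial>lborel) = (\<integral>t. f z * cnj (indicator {0..1} t *\<^sub>R g (e t)) \<partial>lborel)"
      by (simp add: K_def Fe)
    also have "\<dots> = f z * cnj (g 0)"
      using mean by (simp add: set_lebesgue_integral_def del: complex_cnj_scaleR)
    finally show ?thesis
      by (simp add: g_def)
  qed
  have "L2_inner f h = (\<integral>t. indicator {0..1::real} t *\<^sub>R L2_inner f h \<partial>lborel)"
    by simp
  also have "\<dots> = (\<integral>t. (\<integral>z. K t z \<partial>borel_ball_measure) \<partial>lborel)"
    by (simp add: K_def rot inner)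
  also have "\<dots> = (\<integral>z. (\<integral>t. K t z \<partial>lborel) \<partial>borel_ball_measure)"
    by (rule Fubini_integral[symmetric, OF intK])
  also have "\<dots> = (\<integral>z. f z * cnj (0 ^ m * h 0) \<partial>borel_ball_measure)"
  proof (rule integral_cong_AE)
    show "AE z in borel_ball_measure. (\<integral>t. K t z \<partial>lborel) = f z * cnj (0 ^ m * h 0)"
      using AE_borel_ball_measure by eventually_elim (rule slice)
    show "(\<lambda>z. \<integral>t. K t z \<partial>lborel) \<in> borel_measurable borel_ball_measure"
      by (rule lborel.borel_measurable_lebesgue_integral) (simp add: K_def case_prod_unfold, measurable)
  qed measurable
  also have "\<dots> = (\<integral>z. f z \<partial>borel_ball_measure) * cnj (0 ^ m * h 0)"
    by simp
  finally show ?thesis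
    by (simp add: integral_borel_ball_measure)
qed

subsection \<open>Bergman projections of circle-homogeneous functions\<close>

lemma L2_ball_diff:
  assumes "f \<in> L2_ball" "g \<in> L2_ball"
  shows "(\<lambda>z. f z - g z) \<in> L2_ball"
proof -
  have [measurable]: "f \<in> borel_measurable ball_measure" "g \<in> borel_measurable ball_measure"
    using assms by (auto simp: L2_ball_def)
  have "integrable ball_measure (\<lambda>z. (cmod (f z - g z))\<^sup>2)"
  proof (rule Bochner_Integration.integrable_bound)
    show "integrable ball_measure (\<lambda>z. 2 * (cmod (f z))\<^sup>2 + 2 * (cmod (g z))\<^sup>2)"
      using assms by (auto simp: L2_ball_def)
    have "(cmod (a - b))\<^sup>2 \<le> 2 * (cmod a)\<^sup>2 + 2 * (cmod b)\<^sup>2" for a b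
    proof -
      have "(cmod (a - b))\<^sup>2 \<le> (cmod a + cmod b)\<^sup>2"
        by (intro power_mono norm_triangle_ineq4) simp
      also have "\<dots> \<le> 2 * (cmod a)\<^sup>2 + 2 * (cmod b)\<^sup>2"
        using sum_squares_bound[of "cmod a" "cmod b"] by (simp add: power2_sum)
      finally show ?thesis .
    qed
    then show "AE z in ball_measure. norm ((cmod (f z - g z))\<^sup>2)
        \<le> norm (2 * (cmod (f z))\<^sup>2 + 2 * (cmod (g z))\<^sup>2)"
      by (intro always_eventually) simp
  qed measurable
  then show ?thesis
    by (simp add: L2_ball_def)
qed

lemma L2_inner_diff_left:
  assumes "f \<in> L2_ball" "g \<in> L2_ball" "h \<in> L2_ball"
  shows "L2_inner (\<lambda>z. f z - g z) h = L2_inner f h - L2_inner g h"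
  using L2_ball_mult_integrable[OF assms(1,3)] L2_ball_mult_integrable[OF assms(2,3)]
  by (simp add: L2_inner_def left_diff_distrib)

lemma holomorphic_several_diff:
  assumes "holomorphic_several f S" "holomorphic_several g S"
  shows "holomorphic_several (\<lambda>z. f z - g z) S"
  unfolding holomorphic_several_def
proof
  fix z assume "z \<in> S"
  then obtain f' g' where
    "(f has_derivative f') (at z)" "\<And>c v. f' (c *s v) = c * f' v"
    "(g has_derivative g') (at z)" "\<And>c v. g' (c *s v) = c * g' v"
    using assms unfolding holomorphic_several_def by meson
  then show "\<exists>h'. ((\<lambda>z. f z - g z) has_derivative h') (at z) \<and> (\<forall>c v. h' (c *s v) = c * h' v)"
    by (intro exI[of _ "\<lambda>v. f' v - g' v"]) (auto simp: right_diff_distrib intro: has_derivative_diff)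
qed

lemma Bergman_space_diff:
  assumes "f \<in> Bergman_space" "g \<in> Bergman_space"
  shows "(\<lambda>z. f z - g z) \<in> Bergman_space"
  using assms by (auto simp: Bergman_space_def L2_ball_diff holomorphic_several_diff)

text \<open>Zero norm gives vanishing almost everywhere. By continuity the set in the ball where
  \<open>f\<close> does not vanish is open, and an open null set is empty.\<close>

lemma Bergman_space_eq_0:
  assumes f: "f \<in> Bergman_space" and inner: "L2_inner f f = 0" and z: "z \<in> unit_ball"
  shows "f z = 0"
proof (rule ccontr)
  assume nz: "f z \<noteq> 0"
  have int: "integrable ball_measure (\<lambda>z. (cmod (f z))\<^sup>2)" and cont: "continuous_on unit_ball f"
    using f by (auto simp: Bergman_space_def L2_ball_def continuous_holomorphic_several)
  have "L2_inner f f = of_real (LINT z|ball_measure. (cmod (f z))\<^sup>2)"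
    unfolding L2_inner_def integral_complex_of_real[symmetric] by (simp only: complex_norm_square)
  then have "AE z in ball_measure. (cmod (f z))\<^sup>2 = 0"
    using inner integral_nonneg_eq_0_iff_AE[OF int] by simp
  then have "AE z in lebesgue. z \<notin> {z \<in> unit_ball. f z \<noteq> 0}"
    unfolding AE_ball_measure by (rule eventually_mono) auto
  moreover have open': "open {z \<in> unit_ball. f z \<noteq> 0}"
  proof -
    have "open (unit_ball \<inter> f -` (- {0}))"
      by (rule continuous_open_preimage[OF cont]) (auto simp: unit_ball_def)
    moreover have "unit_ball \<inter> f -` (- {0}) = {z \<in> unit_ball. f z \<noteq> 0}" by auto
    ultimately show ?thesis by simp
  qed
  ultimately have "{z \<in> unit_ball. f z \<noteq> 0} \<in> null_sets lebesgue"
    by (subst AE_iff_null_sets) (auto intro: borel_open)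
  then have "negligible {z \<in> unit_ball. f z \<noteq> 0}"
    by (simp add: negligible_iff_null_sets)
  with open_not_negligible[OF open'] show False
    using z nz by blast
qed

text \<open>Resolves the definite description: the difference of two candidates lies in the Bergman
  space and is orthogonal to itself, hence vanishes on the ball, and both candidates are 0
  outside.\<close>

lemma Bergman_projection_eqI:
  fixes f g :: "complex ^ 'n \<Rightarrow> complex"
  assumes f: "f \<in> L2_ball" and g: "g \<in> Bergman_space" and out: "\<And>z. z \<notin> unit_ball \<Longrightarrow> g z = 0"
    and inner: "\<And>h. h \<in> Bergman_space \<Longrightarrow> L2_inner f h = L2_inner g h"
  shows "Bergman_projection f = g"
  unfolding Bergman_projection_def
proof (rule the_equality, intro conjI allI impI ballI)
  have L2: "h \<in> L2_ball" if "h \<in> Bergman_space" for h :: "complex ^ 'n \<Rightarrow> complex"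
    using that by (simp add: Bergman_space_def)
  fix h :: "complex ^ 'n \<Rightarrow> complex" assume "h \<in> Bergman_space"
  then show "L2_inner (\<lambda>z. f z - g z) h = 0"
    using f g L2 inner by (subst L2_inner_diff_left) auto
next
  have L2: "h \<in> L2_ball" if "h \<in> Bergman_space" for h :: "complex ^ 'n \<Rightarrow> complex"
    using that by (simp add: Bergman_space_def)
  fix k assume k: "k \<in> Bergman_space \<and> (\<forall>z. z \<notin> unit_ball \<longrightarrow> k z = 0) \<and>
    (\<forall>h\<in>Bergman_space. L2_inner (\<lambda>z. f z - k z) h = 0)"
  define d where "d = (\<lambda>z. k z - g z)"
  have d: "d \<in> Bergman_space"
    unfolding d_def using k g by (intro Bergman_space_diff) auto
  have "L2_inner f d - L2_inner k d = 0"
    using k d f L2 by (subst L2_inner_diff_left[symmetric]) auto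
  then have "L2_inner k d - L2_inner g d = 0"
    using inner[OF d] by simp
  then have "L2_inner d d = 0"
    using k g d L2 L2_inner_diff_left[of k g d] by (auto simp: d_def)
  then have "d z = 0" if "z \<in> unit_ball" for z
    using Bergman_space_eq_0[OF d] that by blast
  then have "k z = g z" for z
    using k out by (cases "z \<in> unit_ball") (auto simp: d_def)
  then show "k = g" ..
qed (use g out in auto)

text \<open>The candidate is constant on the ball. Tested against \<open>h\<close>, the function of
  weight \<open>m\<close> and the constant of weight 0 both yield the mean of \<open>f\<close> times
  \<open>cnj (0 ^ m * h 0)\<close>. The convention \<open>0 ^ 0 = 1\<close> treats the invariant
  case and the case of projection 0 together.\<close>

lemma Bergman_projection_circle_homogeneous:
  fixes f :: "complex ^ 'n \<Rightarrow> complex"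
  assumes f: "f \<in> borel_measurable borel"
    and bound: "\<And>z. z \<in> unit_ball \<Longrightarrow> cmod (f z) \<le> B"
    and hom: "\<And>c z. cmod c = 1 \<Longrightarrow> f (c *s z) = cnj c ^ m * f z"
  shows "Bergman_projection f = (\<lambda>z. if z \<in> unit_ball then 0 ^ m * (LINT z|ball_measure. f z) else 0)"
    (is "_ = ?g")
proof (rule Bergman_projection_eqI)
  interpret prob_space "ball_measure :: (complex ^ 'n) measure"
    by (rule prob_space_ball_measure)
  define c where "c = 0 ^ m * (LINT z|ball_measure. f z)"
  show "f \<in> L2_ball"
    by (rule L2_ballI[OF f bound])
  have g: "?g = (\<lambda>z. if z \<in> unit_ball then c else 0)"
    unfolding c_def ..
  have "?g \<in> L2_ball"
    unfolding g by (rule L2_ballI[where B = "cmod c"]) auto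
  moreover have "holomorphic_several ?g unit_ball"
    unfolding holomorphic_several_def g
  proof
    fix z :: "complex ^ 'n" assume z: "z \<in> unit_ball"
    have "((\<lambda>z. if z \<in> unit_ball then c else 0) has_derivative (\<lambda>_. 0)) (at z)"
      by (rule has_derivative_transform_within_open[of "\<lambda>_. c" _ _ _ unit_ball])
        (use z in \<open>auto simp: unit_ball_def\<close>)
    then show "\<exists>f'. ((\<lambda>z. if z \<in> unit_ball then c else 0) has_derivative f') (at z)
        \<and> (\<forall>c v. f' (c *s v) = c * f' v)"
      by (intro exI[of _ "\<lambda>_. 0"]) auto
  qed
  ultimately show "?g \<in> Bergman_space"
    by (simp add: Bergman_space_def)
  fix h :: "complex ^ 'n \<Rightarrow> complex" assume h: "h \<in> Bergman_space"
  have "L2_inner ?g h = L2_inner (\<lambda>z. c) h"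
    unfolding L2_inner_def g
  proof (rule integral_cong_AE)
    have [measurable]: "h \<in> borel_measurable ball_measure"
      using h by (auto simp: Bergman_space_def L2_ball_def)
    have [measurable]: "(\<lambda>z :: complex ^ 'n. if z \<in> unit_ball then c else 0) \<in> borel_measurable ball_measure"
      by (rule borel_imp_ball_measurable) simp
    show "(\<lambda>z. (if z \<in> unit_ball then c else 0) * cnj (h z)) \<in> borel_measurable ball_measure"
      by measurable
    show "(\<lambda>z. c * cnj (h z)) \<in> borel_measurable ball_measure"
      by measurable
    show "AE z in ball_measure. (if z \<in> unit_ball then c else 0) * cnj (h z) = c * cnj (h z)"
      using AE_unit_ball by eventually_elim simp
  qed
  also have "\<dots> = (LINT z|(ball_measure :: (complex ^ 'n) measure). c) * cnj (0 ^ 0 * h 0)"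
    by (rule L2_inner_circle_homogeneous[where B = "cmod c"]) (use h in auto)
  also have "\<dots> = (LINT z|ball_measure. f z) * cnj (0 ^ m * h 0)"
    using prob_space by (simp add: c_def)
  also have "\<dots> = L2_inner f h"
    by (rule L2_inner_circle_homogeneous[symmetric]) (use f bound hom h in auto)
  finally show "L2_inner f h = L2_inner ?g h" by simp
qed simp

subsection \<open>Polynomials and their derivatives\<close>

text \<open>A single index holding both multi-indices turns polynomials into plain finite
  sums.\<close>

definition conj_monomial :: "('n \<Rightarrow> nat) \<times> ('n \<Rightarrow> nat) \<Rightarrow> complex ^ 'n \<Rightarrow> complex" where
  "conj_monomial p z = (\<Prod>j\<in>UNIV. (z $ j) ^ fst p j * cnj (z $ j) ^ snd p j)"

lemma conj_polynomials_iff: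
  "f \<in> conj_polynomials \<longleftrightarrow> (\<exists>S c. finite S \<and> f = (\<lambda>z. \<Sum>p\<in>S. c p * conj_monomial p z))"
proof -
  have eq: "(\<Sum>(a, b)\<in>S. c a b * (\<Prod>j\<in>UNIV. (z $ j) ^ a j * cnj (z $ j) ^ b j))
      = (\<Sum>p\<in>S. case_prod c p * conj_monomial p z)" for c S and z :: "complex ^ 'n"
    by (simp add: conj_monomial_def case_prod_unfold)
  then have "f \<in> conj_polynomials \<longleftrightarrow> (\<exists>S c. finite S \<and> f = (\<lambda>z. \<Sum>p\<in>S. case_prod c p * conj_monomial p z))"
    by (simp only: conj_polynomials_def mem_Collect_eq eq)
  also have "\<dots> \<longleftrightarrow> (\<exists>S c. finite S \<and> f = (\<lambda>z. \<Sum>p\<in>S. c p * conj_monomial p z))"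
    (is "?L \<longleftrightarrow> ?R")
  proof
    assume ?R
    then obtain S c where "finite S" "f = (\<lambda>z. \<Sum>p\<in>S. case_prod (curry c) p * conj_monomial p z)"
      by (auto simp: case_prod_curry)
    then show ?L by blast
  qed blast
  finally show ?thesis .
qed

lemma conj_polynomialsI:
  assumes "finite S" and "\<And>z. f z = (\<Sum>p\<in>S. c p * conj_monomial p z)"
  shows "f \<in> conj_polynomials"
proof -
  have "f = (\<lambda>z. \<Sum>p\<in>S. c p * conj_monomial p z)"
    using assms(2) by (rule ext)
  with assms(1) show ?thesis
    unfolding conj_polynomials_iff by (intro exI conjI)
qed

lemma conj_monomial_in_conj_polynomials: "conj_monomial p \<in> conj_polynomials"
  by (rule conj_polynomialsI[of "{p}" _ "\<lambda>_. 1"]) auto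

lemma conj_monomial_mult:
  "conj_monomial p z * conj_monomial q z
    = conj_monomial (\<lambda>j. fst p j + fst q j, \<lambda>j. snd p j + snd q j) z"
  by (simp add: conj_monomial_def power_add prod.distrib[symmetric] mult_ac)

lemma conj_polynomials_add:
  assumes "f \<in> conj_polynomials" "g \<in> conj_polynomials"
  shows "(\<lambda>z. f z + g z) \<in> conj_polynomials"
proof -
  obtain S c where S: "finite S" and f: "f = (\<lambda>z. \<Sum>p\<in>S. c p * conj_monomial p z)"
    using assms(1) unfolding conj_polynomials_iff by blast
  obtain T d where T: "finite T" and g: "g = (\<lambda>z. \<Sum>p\<in>T. d p * conj_monomial p z)"
    using assms(2) unfolding conj_polynomials_iff by blast
  have "f z = (\<Sum>p\<in>S \<union> T. (if p \<in> S then c p else 0) * conj_monomial p z)" for z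
    unfolding f using S T by (intro sum.mono_neutral_cong_left) auto
  moreover have "g z = (\<Sum>p\<in>S \<union> T. (if p \<in> T then d p else 0) * conj_monomial p z)" for z
    unfolding g using S T by (intro sum.mono_neutral_cong_left) auto
  ultimately have "f z + g z = (\<Sum>p\<in>S \<union> T. ((if p \<in> S then c p else 0) + (if p \<in> T then d p else 0))
      * conj_monomial p z)" for z
    by (simp only: sum.distrib distrib_right)
  with S T show ?thesis
    by (intro conj_polynomialsI[of "S \<union> T"]) auto
qed

lemma conj_polynomials_sum:
  assumes "finite A" "A \<noteq> {}" "\<And>j. j \<in> A \<Longrightarrow> f j \<in> conj_polynomials"
  shows "(\<lambda>z. \<Sum>j\<in>A. f j z) \<in> conj_polynomials"
  using assms by (induction A rule: finite_ne_induct) (auto intro: conj_polynomials_add)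

text \<open>Multiplication shifts all index pairs by \<open>p\<close>. The shift is injective, so no
  terms collide and \<open>inv s\<close> recovers the old coefficient.\<close>

lemma conj_polynomials_monomial_mult:
  assumes "f \<in> conj_polynomials"
  shows "(\<lambda>z. conj_monomial p z * f z) \<in> conj_polynomials"
proof -
  obtain S c where S: "finite S" and f: "f = (\<lambda>z. \<Sum>q\<in>S. c q * conj_monomial q z)"
    using assms unfolding conj_polynomials_iff by blast
  define s :: "('a \<Rightarrow> nat) \<times> ('a \<Rightarrow> nat) \<Rightarrow> _"
    where "s q = (\<lambda>j. fst p j + fst q j, \<lambda>j. snd p j + snd q j)" for q
  have s: "inj s"
    by (auto simp: inj_def s_def fun_eq_iff prod_eq_iff)
  have "conj_monomial p z * f z = (\<Sum>q\<in>S. c q * conj_monomial (s q) z)" for z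
    by (simp add: f sum_distrib_left s_def mult.left_commute conj_monomial_mult)
  also have "(\<Sum>q\<in>S. c q * conj_monomial (s q) z) = (\<Sum>q\<in>s ` S. c (inv s q) * conj_monomial q z)" for z
    using s by (subst sum.reindex) (auto simp: inj_on_def inj_def)
  finally have "conj_monomial p z * f z = (\<Sum>q\<in>s ` S. c (inv s q) * conj_monomial q z)" for z .
  with S show ?thesis
    by (intro conj_polynomialsI[of "s ` S"]) auto
qed

lemma norm_power2_vec: "complex_of_real ((norm z)\<^sup>2) = (\<Sum>j\<in>UNIV. z $ j * cnj (z $ j))" for z :: "complex ^ 'n"
  unfolding complex_norm_square[symmetric] of_real_sum[symmetric]
  by (simp add: norm_vec_def L2_set_def sum_nonneg)

lemma prod_power_if:
  fixes f :: "'n::finite \<Rightarrow> 'a::comm_semiring_1"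
  shows "(\<Prod>j\<in>UNIV. f j ^ (if j = i then 1 else 0)) = f i"
proof -
  have "(\<Prod>j\<in>UNIV. f j ^ (if j = i then 1 else 0)) = (\<Prod>j\<in>UNIV. if j = i then f j else 1)"
    by (intro prod.cong) auto
  then show ?thesis by simp
qed

text \<open>Membership of the test functions in \<open>D\<close>. Each induction step multiplies by
  the squared norm, which is the sum of the monomials \<open>z $ l * cnj (z $ l)\<close>.\<close>

lemma conj_polynomial_cnj_norm:
  "(\<lambda>z :: complex ^ 'n. cnj (z $ i) * of_real (norm z) ^ (2 * k)) \<in> conj_polynomials"
proof (induction k)
  case 0
  have "conj_monomial (\<lambda>_. 0, \<lambda>j. if j = i then 1 else 0) = (\<lambda>z :: complex ^ 'n. cnj (z $ i))"
    by (rule ext) (simp only: conj_monomial_def fst_conv snd_conv power_0 mult_1 prod_power_if)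
  then show ?case
    using conj_monomial_in_conj_polynomials[of "(\<lambda>_. 0, \<lambda>j. if j = i then 1 else 0)"]
    by (simp only: mult_zero_right power_0 mult_1_right)
next
  case (Suc k)
  define p :: "'n \<Rightarrow> ('n \<Rightarrow> nat) \<times> ('n \<Rightarrow> nat)"
    where "p l = (\<lambda>j. if j = l then 1 else 0, \<lambda>j. if j = l then 1 else 0)" for l
  have p: "conj_monomial (p l) z = z $ l * cnj (z $ l)" for l z
    by (simp only: conj_monomial_def p_def fst_conv snd_conv prod.distrib prod_power_if)
  have "cnj (z $ i) * of_real (norm z) ^ (2 * Suc k)
      = (\<Sum>l\<in>UNIV. conj_monomial (p l) z * (cnj (z $ i) * of_real (norm z) ^ (2 * k)))" for z
    unfolding p sum_distrib_right[symmetric] norm_power2_vec[symmetric]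
    by (simp add: power2_eq_square)
  moreover have "(\<lambda>z. \<Sum>l\<in>UNIV. conj_monomial (p l) z * (cnj (z $ i) * of_real (norm z) ^ (2 * k))) \<in> conj_polynomials"
    by (intro conj_polynomials_sum conj_polynomials_monomial_mult Suc.IH) auto
  ultimately show ?case by simp
qed

text \<open>Product rule: the conjugate derivative of \<open>cnj (z $ i)\<close> is 1 and that of
  the squared norm is \<open>z $ i\<close>.\<close>

lemma wirtinger_conj_cnj_norm:
  "wirtinger_conj i (\<lambda>z :: complex ^ 'n. cnj (z $ i) * of_real (norm z) ^ (2 * Suc k))
    = (\<lambda>z. of_real ((norm z) ^ (2 * Suc k) + real (Suc k) * (cmod (z $ i))\<^sup>2 * norm z ^ (2 * k)))"
proof
  fix z :: "complex ^ 'n"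
  define N where "N = (norm z)\<^sup>2"
  define f where "f z = cnj (z $ i) * of_real (norm z) ^ (2 * Suc k)" for z :: "complex ^ 'n"
  \<comment> \<open>One computation for an arbitrary direction \<open>c\<close> serves both real
    partial derivatives, \<open>c = 1\<close> and \<open>c = \<i>\<close>.\<close>
  have dir: "vector_derivative (\<lambda>t::real. f (z + t *\<^sub>R axis i c)) (at 0)
      = cnj c * of_real N ^ Suc k + cnj (z $ i) * of_real (real (Suc k) * N ^ k * (2 * (z $ i \<bullet> c)))"
    for c
  proof (rule vector_derivative_at)
    \<comment> \<open>Along a line the squared norm is a quadratic polynomial in \<open>t\<close>,
      so no square root has to be differentiated, not even at the origin.\<close>
    have norm: "(norm (z + t *\<^sub>R axis i c))\<^sup>2 = N + 2 * t * (z $ i \<bullet> c) + t\<^sup>2 * (cmod c)\<^sup>2" for t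
      unfolding N_def power2_norm_eq_inner
      by (simp add: inner_axis inner_axis_axis inner_commute power2_eq_square algebra_simps)
    have eq: "f (z + t *\<^sub>R axis i c)
        = (cnj (z $ i) + t *\<^sub>R cnj c) * of_real ((N + 2 * t * (z $ i \<bullet> c) + t\<^sup>2 * (cmod c)\<^sup>2) ^ Suc k)" for t
      unfolding norm[symmetric] f_def by (simp add: power_mult power2_eq_square power_mult_distrib)
    have q: "((\<lambda>t. N + 2 * t * (z $ i \<bullet> c) + t\<^sup>2 * (cmod c)\<^sup>2)
        has_real_derivative 2 * (z $ i \<bullet> c)) (at 0)"
      by (auto intro!: derivative_eq_intros)
    have "((\<lambda>t. (N + 2 * t * (z $ i \<bullet> c) + t\<^sup>2 * (cmod c)\<^sup>2) ^ Suc k)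
        has_real_derivative real (Suc k) * N ^ k * (2 * (z $ i \<bullet> c))) (at 0)"
      using DERIV_power_Suc[OF q, of k] by (simp add: mult_ac del: power_Suc)
    then have "((\<lambda>t. complex_of_real ((N + 2 * t * (z $ i \<bullet> c) + t\<^sup>2 * (cmod c)\<^sup>2) ^ Suc k))
        has_vector_derivative of_real (real (Suc k) * N ^ k * (2 * (z $ i \<bullet> c)))) (at 0)"
      by (rule has_vector_derivative_of_real)
    then have "((\<lambda>t. (cnj (z $ i) + t *\<^sub>R cnj c) * of_real ((N + 2 * t * (z $ i \<bullet> c) + t\<^sup>2 * (cmod c)\<^sup>2) ^ Suc k))
      has_vector_derivative (cnj (z $ i) + 0 *\<^sub>R cnj c) * of_real (real (Suc k) * N ^ k * (2 * (z $ i \<bullet> c)))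
        + cnj c * of_real ((N + 2 * 0 * (z $ i \<bullet> c) + 0\<^sup>2 * (cmod c)\<^sup>2) ^ Suc k)) (at 0)"
      by (intro has_vector_derivative_mult) (auto intro!: derivative_eq_intros)
    then show "((\<lambda>t. f (z + t *\<^sub>R axis i c)) has_vector_derivative
        cnj c * of_real N ^ Suc k + cnj (z $ i) * of_real (real (Suc k) * N ^ k * (2 * (z $ i \<bullet> c)))) (at 0)"
      unfolding eq by (simp add: add.commute)
  qed
  \<comment> \<open>The terms with \<open>cnj c\<close> combine to
    \<open>(1 + \<i> * (- \<i>)) / 2 = 1\<close>. In the other term the 2 from the derivative of the
    squared norm cancels the half.\<close>
  have "wirtinger_conj i f z = of_real N ^ Suc k + of_real (real (Suc k) * N ^ k)
      * (cnj (z $ i) * (of_real (z $ i \<bullet> 1) + \<i> * of_real (z $ i \<bullet> \<i>)))"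
    unfolding wirtinger_conj_def dir by (simp add: field_simps)
  also have "of_real (z $ i \<bullet> 1) + \<i> * of_real (z $ i \<bullet> \<i>) = z $ i"
    by (simp add: complex_eq_iff inner_complex_def)
  also have "cnj (z $ i) * z $ i = of_real ((cmod (z $ i))\<^sup>2)"
    by (metis complex_norm_square mult.commute)
  finally show "wirtinger_conj i (\<lambda>z :: complex ^ 'n. cnj (z $ i) * of_real (norm z) ^ (2 * Suc k)) z
    = of_real ((norm z) ^ (2 * Suc k) + real (Suc k) * (cmod (z $ i))\<^sup>2 * norm z ^ (2 * k))"
    unfolding f_def[symmetric] N_def by (simp add: power_mult power2_eq_square power_mult_distrib mult_ac)
qed

subsection \<open>Moments of the norm\<close>

lemma integral_ball_measure_isometry:
  fixes g :: "complex ^ 'n \<Rightarrow> 'b::{banach, second_countable_topology}"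
    and f :: "complex ^ 'n \<Rightarrow> complex ^ 'n"
  assumes [measurable]: "g \<in> borel_measurable borel"
    and "linear f" and norm: "\<And>x. norm (f x) = norm x"
  shows "(LINT z|ball_measure. g (f z)) = integral\<^sup>L ball_measure g"
proof -
  have [measurable]: "f \<in> borel_measurable borel"
    using assms(2) by (simp add: borel_measurable_continuous_onI linear_continuous_on linear_conv_bounded_linear)
  have "(LINT z|ball_measure. g (f z)) = (LINT z|borel_ball_measure. g (f z))"
    by (rule integral_borel_ball_measure[symmetric]) measurable
  also have "\<dots> = integral\<^sup>L (distr borel_ball_measure borel f) g"
    by (rule integral_distr[symmetric]) measurable
  also have "\<dots> = integral\<^sup>L ball_measure g"
    using distr_borel_ball_measure[OF assms(2) norm] by (simp add: integral_borel_ball_measure)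
  finally show ?thesis .
qed

lemma integrable_ball_measure_bounded:
  fixes g :: "complex ^ 'n \<Rightarrow> 'b::{banach, second_countable_topology}"
  assumes g: "g \<in> borel_measurable borel" and "\<And>z. z \<in> unit_ball \<Longrightarrow> norm (g z) \<le> B"
  shows "integrable ball_measure g"
proof -
  interpret prob_space ball_measure by (rule prob_space_ball_measure)
  show ?thesis
  proof (rule integrable_const_bound)
    show "AE z in ball_measure. norm (g z) \<le> B"
      using AE_unit_ball by eventually_elim (use assms(2) in auto)
  qed (rule borel_imp_ball_measurable[OF g])
qed

text \<open>Swapping the coordinates \<open>i\<close> and \<open>j\<close> is a linear isometry, and
  those preserve the measure.\<close>

lemma integral_coordinate_norm_power:
  fixes i j :: "'n::finite"
  shows "(LINT z|(ball_measure :: (complex ^ 'n) measure). (cmod (z $ i))\<^sup>2 * norm z ^ m)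
    = (LINT z|ball_measure. (cmod (z $ j))\<^sup>2 * norm z ^ m)"
proof -
  define s :: "complex ^ 'n \<Rightarrow> complex ^ 'n" where "s z = (\<chi> l. z $ Transposition.transpose i j l)" for z
  have "linear s"
    by (intro linearI) (simp_all add: s_def vec_eq_iff)
  have norm: "norm (s z) = norm z" for z
  proof -
    have "(\<Sum>l\<in>UNIV. (cmod (z $ Transposition.transpose i j l))\<^sup>2) = (\<Sum>l\<in>UNIV. (cmod (z $ l))\<^sup>2)"
      by (rule sum.reindex_bij_betw) simp
    then show ?thesis by (simp add: norm_vec_def L2_set_def s_def)
  qed
  have si: "s z $ i = z $ j" for z
    by (simp add: s_def)
  have "(LINT z|ball_measure. (cmod (s z $ i))\<^sup>2 * norm (s z) ^ m)
      = (LINT z|(ball_measure :: (complex ^ 'n) measure). (cmod (z $ i))\<^sup>2 * norm z ^ m)"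
    by (rule integral_ball_measure_isometry[where g = "\<lambda>z. (cmod (z $ i))\<^sup>2 * norm z ^ m"])
      (use \<open>linear s\<close> norm in \<open>auto intro!: borel_measurable_continuous_onI continuous_intros\<close>)
  then show ?thesis
    by (simp add: norm si)
qed

lemma integrable_coordinate_norm_power:
  "integrable ball_measure (\<lambda>z :: complex ^ 'n. (cmod (z $ i))\<^sup>2 * norm z ^ m)"
proof (rule integrable_ball_measure_bounded)
  show "(\<lambda>z :: complex ^ 'n. (cmod (z $ i))\<^sup>2 * norm z ^ m) \<in> borel_measurable borel"
    by (intro borel_measurable_continuous_onI continuous_intros)
  fix z :: "complex ^ 'n" assume "z \<in> unit_ball"
  then have "norm z \<le> 1" by (simp add: unit_ball_def)
  moreover have "cmod (z $ i) \<le> 1"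
    using Finite_Cartesian_Product.norm_nth_le[of z i] \<open>norm z \<le> 1\<close> by simp
  ultimately show "norm ((cmod (z $ i))\<^sup>2 * norm z ^ m) \<le> 1"
    by (simp add: norm_mult norm_power mult_le_one power_le_one)
qed

lemma integrable_norm_power: "integrable ball_measure (\<lambda>z :: complex ^ 'n. norm z ^ m)"
proof (rule integrable_ball_measure_bounded)
  show "(\<lambda>z :: complex ^ 'n. norm z ^ m) \<in> borel_measurable borel"
    by (intro borel_measurable_continuous_onI continuous_intros)
  show "norm (norm z ^ m) \<le> 1" if "z \<in> unit_ball" for z :: "complex ^ 'n"
    using that by (simp add: unit_ball_def power_le_one)
qed

text \<open>The squared norm is the sum of the squared moduli of the coordinates, and by symmetry
  each contributes the same integral.\<close>

lemma CARD_integral_coordinate_norm_power: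
  fixes i :: "'n::finite"
  shows "real CARD('n) * (LINT z|(ball_measure :: (complex ^ 'n) measure). (cmod (z $ i))\<^sup>2 * norm z ^ m)
    = (LINT z|(ball_measure :: (complex ^ 'n) measure). norm z ^ (m + 2))"
proof -
  have sq: "(norm z)\<^sup>2 = (\<Sum>j\<in>UNIV. (cmod (z $ j))\<^sup>2)" for z :: "complex ^ 'n"
    by (simp add: norm_vec_def L2_set_def sum_nonneg)
  have "(LINT z|(ball_measure :: (complex ^ 'n) measure). norm z ^ (m + 2))
      = (LINT z|(ball_measure :: (complex ^ 'n) measure). (\<Sum>j\<in>UNIV. (cmod (z $ j))\<^sup>2 * norm z ^ m))"
    unfolding power_add sq sum_distrib_right[symmetric] by (simp add: mult.commute)
  also have "\<dots> = (\<Sum>j\<in>(UNIV::'n set). LINT z|(ball_measure :: (complex ^ 'n) measure). (cmod (z $ j))\<^sup>2 * norm z ^ m)"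
    by (rule Bochner_Integration.integral_sum) (rule integrable_coordinate_norm_power)
  also have "\<dots> = (\<Sum>j\<in>(UNIV::'n set). LINT z|(ball_measure :: (complex ^ 'n) measure). (cmod (z $ i))\<^sup>2 * norm z ^ m)"
    by (intro sum.cong integral_coordinate_norm_power refl)
  finally show ?thesis by simp
qed

section \<open>Lower bound and decay of the radial moments\<close>

lemma measure_ball_measure_ball:
  assumes "0 \<le> r" "r \<le> 1"
  shows "measure ball_measure (ball (0 :: complex ^ 'n) r) = r ^ DIM(complex ^ 'n)"
proof -
  have "unit_ball \<inter> ball (0 :: complex ^ 'n) r = ball 0 r"
    using assms by (auto simp: unit_ball_def)
  moreover have "measure lborel (ball (0 :: complex ^ 'n) 1) > 0"
    by (rule content_ball_pos) simp
  ultimately show ?thesis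
    unfolding ball_measure_def
    using emeasure_unit_ball[where 'n='n] content_ball_conv_unit_ball[of r "0 :: complex ^ 'n"] assms
    by (subst measure_uniform_measure) (auto simp: unit_ball_def)
qed

text \<open>Only the outer shell \<open>norm z \<ge> r\<close> is kept: the integrand there is at
  least 1/4 and the shell has mass at least \<open>1 / (2 * real m)\<close>.\<close>

lemma integral_norm_power_ge:
  assumes "m > 0"
  shows "1 / (8 * real m) \<le> (LINT z|(ball_measure :: (complex ^ 'n) measure). norm z ^ (2 * m))"
proof -
  interpret prob_space "ball_measure :: (complex ^ 'n) measure" by (rule prob_space_ball_measure)
  \<comment> \<open>The width is chosen so that Bernoulli's inequality gives
    \<open>r ^ m \<ge> 1 / 2\<close>, hence \<open>r ^ (2 * m) \<ge> 1 / 4\<close>.\<close>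
  define r where "r = 1 - 1 / (2 * real m)"
  have r: "0 \<le> r" "r \<le> 1"
    using assms by (auto simp: r_def field_simps)
  have "1 + real m * (- (1 / (2 * real m))) \<le> (1 + (- (1 / (2 * real m)))) ^ m"
    using assms by (intro Bernoulli_inequality) (auto simp: field_simps)
  then have "1 / 2 \<le> r ^ m"
    using assms by (simp add: r_def)
  then have "(1 / 2)\<^sup>2 \<le> (r ^ m)\<^sup>2"
    by (intro power_mono) auto
  moreover have "(r ^ m)\<^sup>2 = r ^ (2 * m)"
    by (simp add: power_mult[symmetric] mult.commute)
  ultimately have rm: "1 / 4 \<le> r ^ (2 * m)"
    by (simp add: power_divide)
  \<comment> \<open>Since the dimension is at least 1, the inner ball has mass at most
    \<open>r\<close>; this makes the bound independent of the dimension.\<close>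
  have "r ^ DIM(complex ^ 'n) \<le> r ^ 1"
    using r by (intro power_decreasing) auto
  then have "1 - r \<le> 1 - prob (ball 0 r)"
    unfolding measure_ball_measure_ball[OF r] by simp
  also have "\<dots> = prob (- ball 0 r)"
    by (subst prob_compl[symmetric]) (auto simp: Compl_eq_Diff_UNIV)
  finally have "1 / (2 * real m) \<le> prob (- ball 0 r)"
    by (simp add: r_def)
  then have "1 / 4 * (1 / (2 * real m)) \<le> r ^ (2 * m) * prob (- ball 0 r)"
    using rm by (intro mult_mono) auto
  also have "\<dots> = (LINT z|(ball_measure :: (complex ^ 'n) measure). r ^ (2 * m) * indicator (- ball 0 r) z)"
    by simp
  also have "\<dots> \<le> (LINT z|(ball_measure :: (complex ^ 'n) measure). norm z ^ (2 * m))"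
  proof (rule integral_mono)
    show "integrable ball_measure (\<lambda>z :: complex ^ 'n. r ^ (2 * m) * indicator (- ball 0 r) z)"
      by (intro integrable_mult_right integrable_real_indicator) (auto simp: less_top[symmetric])
    show "r ^ (2 * m) * indicator (- ball 0 r) z \<le> norm z ^ (2 * m)" for z :: "complex ^ 'n"
      using r by (auto simp: indicator_def power_mono)
  qed (rule integrable_norm_power)
  finally show ?thesis by simp
qed

text \<open>Dominated convergence with the constant 1: the powers tend to 0 at each point of the
  open ball.\<close>

lemma integral_norm_power_tendsto_0:
  "(\<lambda>m. LINT z|(ball_measure :: (complex ^ 'n) measure). norm z ^ m) \<longlonglongrightarrow> 0"
proof -
  interpret prob_space "ball_measure :: (complex ^ 'n) measure" by (rule prob_space_ball_measure)
  have "(\<lambda>m. LINT z|(ball_measure :: (complex ^ 'n) measure). norm z ^ m)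
      \<longlonglongrightarrow> (LINT z|(ball_measure :: (complex ^ 'n) measure). 0)"
  proof (rule integral_dominated_convergence[where w = "\<lambda>_. 1"])
    show "(\<lambda>z :: complex ^ 'n. norm z ^ m) \<in> borel_measurable ball_measure" for m
      using integrable_norm_power by (rule borel_measurable_integrable)
    show "AE z in ball_measure. (\<lambda>m. norm (z :: complex ^ 'n) ^ m) \<longlonglongrightarrow> 0"
      using AE_unit_ball by eventually_elim (simp add: unit_ball_def LIMSEQ_power_zero)
    show "AE z in ball_measure. norm (norm (z :: complex ^ 'n) ^ m) \<le> 1" for m
      using AE_unit_ball by eventually_elim (simp add: unit_ball_def power_le_one)
  qed auto
  then show ?thesis by simp
qed

section \<open>The commutator on the test functions and the contradiction\<close>

lemma wirtinger_conj_0: "wirtinger_conj i (\<lambda>_. 0) = (\<lambda>_. 0)"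
  by (simp add: wirtinger_conj_def fun_eq_iff)

text \<open>The test function has weight 1, so its projection and the derivative of that projection
  vanish. Its conjugate derivative has weight 0, so it projects to its mean.\<close>

lemma Bergman_commutator_cnj_norm:
  fixes i :: "'n::finite"
  assumes "z \<in> unit_ball"
  shows "Bergman_commutator (wirtinger_conj i) (\<lambda>z. cnj (z $ i) * of_real (norm z) ^ (2 * Suc k)) z
    = of_real (LINT z|(ball_measure :: (complex ^ 'n) measure).
        norm z ^ (2 * Suc k) + real (Suc k) * (cmod (z $ i))\<^sup>2 * norm z ^ (2 * k))"
    (is "Bergman_commutator _ ?f z = of_real (LINT z|_. ?g z)")
proof -
  have "Bergman_projection ?f = (\<lambda>z. if z \<in> unit_ball then 0 ^ 1 * (LINT z|ball_measure. ?f z) else 0)"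
  proof (rule Bergman_projection_circle_homogeneous)
    show "?f \<in> borel_measurable borel"
      by (intro borel_measurable_continuous_onI continuous_intros)
    fix z :: "complex ^ 'n"
    show "?f (c *s z) = cnj c ^ 1 * ?f z" if "cmod c = 1" for c
      using that by (simp add: norm_vec_smult)
    assume "z \<in> unit_ball"
    then have "norm z \<le> 1" by (simp add: unit_ball_def)
    moreover have "cmod (z $ i) \<le> 1"
      using Finite_Cartesian_Product.norm_nth_le[of z i] \<open>norm z \<le> 1\<close> by simp
    ultimately show "cmod (?f z) \<le> 1"
      unfolding norm_mult norm_power complex_mod_cnj norm_of_real abs_norm_cancel
      by (intro mult_le_one power_le_one) auto
  qed
  then have Pf: "Bergman_projection ?f = (\<lambda>_. 0)"
    by (simp add: fun_eq_iff)
  \<comment> \<open>Here \<open>m = 0\<close>, so the factor \<open>0 ^ 0\<close> is 1 and the mean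
    survives.\<close>
  have "Bergman_projection (\<lambda>z. of_real (?g z) :: complex)
      = (\<lambda>z. if z \<in> unit_ball then 0 ^ 0 * (LINT z|ball_measure. of_real (?g z)) else 0)"
  proof (rule Bergman_projection_circle_homogeneous)
    show "(\<lambda>z. of_real (?g z) :: complex) \<in> borel_measurable borel"
      by (intro borel_measurable_continuous_onI continuous_intros)
    fix z :: "complex ^ 'n"
    show "of_real (?g (c *s z)) = cnj c ^ 0 * (of_real (?g z) :: complex)" if "cmod c = 1" for c
      using that by (simp add: norm_vec_smult norm_mult)
    assume "z \<in> unit_ball"
    then have z: "norm z \<le> 1" by (simp add: unit_ball_def)
    moreover have zi: "cmod (z $ i) \<le> 1"
      using Finite_Cartesian_Product.norm_nth_le[of z i] \<open>norm z \<le> 1\<close> by simp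
    have "(cmod (z $ i))\<^sup>2 * norm z ^ (2 * k) \<le> 1"
      using z zi by (intro mult_le_one power_le_one) auto
    then have "real (Suc k) * ((cmod (z $ i))\<^sup>2 * norm z ^ (2 * k)) \<le> real (Suc k) * 1"
      by (intro mult_left_mono) auto
    moreover have "norm z ^ (2 * Suc k) \<le> 1"
      using z by (intro power_le_one) auto
    ultimately have "?g z \<le> 1 + real (Suc k)"
      by (simp only: mult.assoc mult_1_right)
    moreover have "0 \<le> ?g z"
      by (intro add_nonneg_nonneg mult_nonneg_nonneg) auto
    ultimately show "cmod (of_real (?g z)) \<le> 1 + real (Suc k)"
      by (simp only: norm_of_real abs_of_nonneg)
  qed
  then show ?thesis
    using assms unfolding Bergman_commutator_def wirtinger_conj_cnj_norm Pf wirtinger_conj_0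
    by (simp del: of_real_add of_real_mult of_real_power power_Suc mult_Suc_right)
qed

theorem theorem7p3p2:
  fixes i :: "'n::finite"
  shows "\<not> (\<exists>T :: (complex ^ 'n \<Rightarrow> complex) \<Rightarrow> (complex ^ 'n \<Rightarrow> complex).
             L2_bounded_operator T \<and>
             (\<forall>f \<in> conj_polynomials. L2_eq (T f) (Bergman_commutator (wirtinger_conj i) f)))"
proof
  assume "\<exists>T :: (complex ^ 'n \<Rightarrow> complex) \<Rightarrow> (complex ^ 'n \<Rightarrow> complex).
             L2_bounded_operator T \<and>
             (\<forall>f \<in> conj_polynomials. L2_eq (T f) (Bergman_commutator (wirtinger_conj i) f))"
  then obtain T :: "(complex ^ 'n \<Rightarrow> complex) \<Rightarrow> (complex ^ 'n \<Rightarrow> complex)"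
    where bounded: "L2_bounded_operator T"
      and ext: "\<forall>f\<in>conj_polynomials. L2_eq (T f) (Bergman_commutator (wirtinger_conj i) f)"
    by (elim exE conjE)
  from bounded have "\<forall>f\<in>L2_ball. T f \<in> L2_ball" "\<exists>C. \<forall>f\<in>L2_ball. L2_norm (T f) \<le> C * L2_norm f"
    unfolding L2_bounded_operator_def by simp_all
  then obtain C where T: "\<forall>f\<in>L2_ball. T f \<in> L2_ball"
      and C: "\<forall>f\<in>L2_ball. L2_norm (T f) \<le> C * L2_norm f"
    by (elim exE)
  interpret prob_space "ball_measure :: (complex ^ 'n) measure" by (rule prob_space_ball_measure)
  \<comment> \<open>The exponent is \<open>2 * Suc k\<close>, so that the power of the squared norm
    starts at 1 for \<open>k = 0\<close>.\<close>
  define f where "f k z = cnj (z $ i) * of_real (norm z) ^ (2 * Suc k)" for k and z :: "complex ^ 'n"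
  define J where "J k = (LINT z|(ball_measure :: (complex ^ 'n) measure).
        norm z ^ (2 * Suc k) + real (Suc k) * (cmod (z $ i))\<^sup>2 * norm z ^ (2 * k))" for k
  have norm_f: "cmod (f k z) = cmod (z $ i) * norm z ^ (2 * Suc k)" for k z
    unfolding f_def norm_mult norm_power complex_mod_cnj norm_of_real abs_norm_cancel ..
  have f_poly: "f k \<in> conj_polynomials" for k
    unfolding f_def[abs_def] by (rule conj_polynomial_cnj_norm)
  have norm_le: "norm z \<le> 1" "cmod (z $ i) \<le> 1" if "z \<in> unit_ball" for z :: "complex ^ 'n"
    using that Finite_Cartesian_Product.norm_nth_le[of z i] by (auto simp: unit_ball_def)
  have f_L2: "f k \<in> L2_ball" for k
  proof (rule L2_ballI)
    show "f k \<in> borel_measurable borel"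
      unfolding f_def[abs_def] by (intro borel_measurable_continuous_onI continuous_intros)
    show "cmod (f k z) \<le> 1" if "z \<in> unit_ball" for z
      unfolding norm_f using norm_le[OF that] by (intro mult_le_one power_le_one) auto
  qed
  \<comment> \<open>The factor \<open>Suc k\<close> produced by differentiation exactly offsets the
    decay of the moment of order \<open>2 * Suc k\<close>. The first summand of \<open>J k\<close>
    is nonnegative and is dropped.\<close>
  have J_ge: "1 / (8 * real CARD('n)) \<le> J k" for k
  proof -
    let ?A = "LINT z|(ball_measure :: (complex ^ 'n) measure). (cmod (z $ i))\<^sup>2 * norm z ^ (2 * k)"
    have "1 / (8 * real (Suc k)) \<le> real CARD('n) * ?A"
      using integral_norm_power_ge[of "Suc k", where 'n = 'n]
      by (simp add: CARD_integral_coordinate_norm_power)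
    then have "1 / (8 * real CARD('n)) \<le> real (Suc k) * ?A"
      by (simp add: field_simps del: of_nat_Suc)
    also have "\<dots> \<le> (LINT z|(ball_measure :: (complex ^ 'n) measure). norm z ^ (2 * Suc k)) + real (Suc k) * ?A"
      by (simp add: integral_nonneg)
    also have "\<dots> = J k"
      unfolding J_def mult.assoc
      by (subst Bochner_Integration.integral_add)
        (simp_all only: integrable_norm_power integral_mult_right_zero
          integrable_mult_right integrable_coordinate_norm_power)
    finally show ?thesis .
  qed
  \<comment> \<open>Almost everywhere \<open>T (f k)\<close> is the constant \<open>J k\<close>, and
    the measure has total mass 1.\<close>
  have norm_Tf: "L2_norm (T (f k)) = \<bar>J k\<bar>" for k
  proof -
    have "(LINT z|ball_measure. (cmod (T (f k) z))\<^sup>2) = (LINT z|(ball_measure :: (complex ^ 'n) measure). (J k)\<^sup>2)"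
    proof (rule integral_cong_AE)
      show "(\<lambda>z. (cmod (T (f k) z))\<^sup>2) \<in> borel_measurable ball_measure"
        using bspec[OF T f_L2, of k] by (auto simp: L2_ball_def)
      show "AE z in ball_measure. (cmod (T (f k) z))\<^sup>2 = (J k)\<^sup>2"
        using AE_unit_ball bspec[OF ext f_poly, of k, unfolded L2_eq_def]
      proof eventually_elim
        case (elim z)
        then have "T (f k) z = of_real (J k)"
          unfolding J_def Bergman_commutator_cnj_norm[OF elim(1), symmetric] f_def[abs_def] by simp
        then show ?case by simp
      qed
    qed simp
    then show ?thesis
      using prob_space by (simp add: L2_norm_def)
  qed
  \<comment> \<open>The squared modulus is at most \<open>norm z ^ (4 * Suc k)\<close>; weakening
    the exponent to \<open>k\<close> lets the limit of the moments apply directly.\<close>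
  have norm_f_le: "L2_norm (f k) \<le> sqrt (LINT z|(ball_measure :: (complex ^ 'n) measure). norm z ^ k)" for k
    unfolding L2_norm_def
  proof (intro real_sqrt_le_mono integral_mono_AE)
    show "integrable ball_measure (\<lambda>z. (cmod (f k z))\<^sup>2)"
      using f_L2[of k] by (simp add: L2_ball_def)
    show "AE z in ball_measure. (cmod (f k z))\<^sup>2 \<le> norm z ^ k"
      using AE_unit_ball
    proof eventually_elim
      case (elim z)
      have "(cmod (f k z))\<^sup>2 = (cmod (z $ i))\<^sup>2 * norm z ^ (4 * Suc k)"
      proof -
        have "2 * Suc k * 2 = 4 * Suc k" by simp
        then show ?thesis
          unfolding norm_f power_mult_distrib power_mult[symmetric] by (simp only:)
      qed
      also have "\<dots> \<le> 1 * norm z ^ (4 * Suc k)"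
        using norm_le[OF elim] by (intro mult_right_mono power_le_one) auto
      also have "\<dots> \<le> norm z ^ k"
        using norm_le[OF elim] unfolding mult_1 by (intro power_decreasing) auto
      finally show ?case .
    qed
  qed (rule integrable_norm_power)
  have "1 / (8 * real CARD('n)) \<le> \<bar>C\<bar> * sqrt (LINT z|(ball_measure :: (complex ^ 'n) measure). norm z ^ k)" for k
  proof -
    have "1 / (8 * real CARD('n)) \<le> L2_norm (T (f k))"
      using J_ge[of k] norm_Tf[of k] by simp
    also have "\<dots> \<le> C * L2_norm (f k)"
      by (rule bspec[OF C f_L2])
    \<comment> \<open>The bound \<open>C\<close> is not assumed nonnegative, and the next estimate
      multiplies by it.\<close>
    also have "\<dots> \<le> \<bar>C\<bar> * L2_norm (f k)"
      by (intro mult_right_mono) (auto simp: L2_norm_def)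
    also have "\<dots> \<le> \<bar>C\<bar> * sqrt (LINT z|(ball_measure :: (complex ^ 'n) measure). norm z ^ k)"
      by (intro mult_left_mono norm_f_le) auto
    finally show ?thesis .
  qed
  \<comment> \<open>The right-hand side tends to 0 while the left-hand side is a fixed positive
    number.\<close>
  moreover have "(\<lambda>k. \<bar>C\<bar> * sqrt (LINT z|(ball_measure :: (complex ^ 'n) measure). norm z ^ k)) \<longlonglongrightarrow> \<bar>C\<bar> * sqrt 0"
    by (intro tendsto_intros integral_norm_power_tendsto_0)
  ultimately have "1 / (8 * real CARD('n)) \<le> \<bar>C\<bar> * sqrt 0"
    by (intro LIMSEQ_le_const) auto
  then show False
    by (simp add: field_simps)
qed

end
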